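(* Let $\mathbf X$ be an $\mathbb R^d$-valued random variable with law $\rho$. Suppose that $\rho=\sum_{i=1}^kq_i\rho_i$ is a stratified probability measure in standard form, with $\rho_i$ an $m_i$-rectifiable probability measure, and that each $\rho_i$ is dimensional regular, i.e. $\dim_I\rho_i=m_i$. Then $$\dim_I\mathbf X=\sum_{i=1}^kq_im_i.$$
   Context: Information dimension: for an $\mathbb R^d$-valued random variable $\mathbf X=(X_1,\dots,X_d)$ with law $\rho$, let $[\mathbf X]$ be the vector of integer parts $[X_i]$ and $\mathbf X_n=[n\mathbf X]/n$ for $n\ge1$. The discrete entropy is $H_\#(\mathbf X_n)=-\sum_{\mathbf j\in\mathbb Z^d}p_{n,\mathbf j}\ln p_{n,\mathbf j}$, where $p_{n,\mathbf j}=\rho\big(\prod_{i=1}^d[\frac{j_i}n,\frac{j_i+1}n)\big)$. The information dimension is $\dim_I\mathbf X=\dim_I\rho=\lim_{n\to\infty}H_\#(\mathbf X_n)/\ln n$, provided the limit exists. An $m$-rectifiable probability measure $\rho$ is dimensional regular if $\dim_I\rho=m$ (in particular the limit exists). $\mathcal H^m$ is the $m$-dimensional Hausdorff measure. A set is countably $m$-rectifiable if it is a countable union of Lipschitz images of bounded subsets of $\mathbb R^m$, and countably $(\mathcal H^m,m)$-rectifiable if some countably $m$-rectifiable set contains $\mathcal H^m$-almost all of it. A Radon measure $\nu$ on $\mathbb R^d$ is $m$-rectifiable if $\nu\ll\mathcal H^m$ and there is a countably $(\mathcal H^m,m)$-rectifiable Borel set $E$ with $\nu(\mathbb R^d\setminus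 E)=0$. A carrier of a nonzero $m$-rectifiable $\nu$ is a set $E=\bigcup_{j\in\mathbb N}f_j(C_j)$ with $f_j:\mathbb R^m\to\mathbb R^d$ Lipschitz, $C_j$ bounded Borel, $f_j|_{C_j}$ injective, and $\nu\ll\mathcal H^m\llcorner E$. A stratified probability measure in standard form is $\rho=\sum_{i=1}^kq_i\rho_i$ with $(q_i)$ a probability vector with strictly positive entries, $\rho_i$ an $m_i$-rectifiable probability measure with carrier $E_i$, $0\le m_1<\dots<m_k\le d$ integers, and the $E_i$ pairwise disjoint. *)

theory Defs
  imports "HOL-Probability.Probability"
begin

section \<open>Information dimension\<close>

definition grid_cell :: "nat \<Rightarrow> int ^ 'd \<Rightarrow> (real ^ 'd) set" where
  "grid_cell n j =
     {x. \<forall>i. real_of_int (j $ i) / real n \<le> x $ i \<and> x $ i < (real_of_int (j $ i) + 1) / real n}"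

text \<open>
  The entropy of the discretisation \<open>[nX]/n\<close> of a random variable with law \<open>\<rho>\<close>. It may be
  infinite, so it is a sum of extended nonnegative reals; the library's real-valued entropy would
  silently become 0 in that case. For a probability measure \<open>\<rho>\<close> every summand \<open>- p ln p\<close> is
  nonnegative, and a cell with \<open>p = 0\<close> contributes 0.
\<close>
definition discrete_entropy :: "(real ^ 'd) measure \<Rightarrow> nat \<Rightarrow> ennreal" where
  "discrete_entropy \<rho> n =
     (\<integral>\<^sup>+ j. ennreal (- (measure \<rho> (grid_cell n j) * ln (measure \<rho> (grid_cell n j))))
        \<partial>count_space (UNIV :: (int ^ 'd) set))"

text \<open>
  ``The limit defining the information dimension exists and equals \<open>D\<close>''. The quotient is
  meaningless for \<open>n \<le> 1\<close>, which does not affect the limit.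
\<close>
definition has_information_dimension :: "(real ^ 'd) measure \<Rightarrow> ereal \<Rightarrow> bool" where
  "has_information_dimension \<rho> D \<longleftrightarrow>
     (\<lambda>n. enn2ereal (discrete_entropy \<rho> n) / ereal (ln (real n))) \<longlonglongrightarrow> D"

section \<open>Hausdorff measure\<close>

text \<open>
  The \<open>m\<close>-dimensional size of a covering set, with the usual normalisation that makes
  \<open>m\<close>-dimensional Hausdorff measure agree with Lebesgue measure on \<open>m\<close>-space. For \<open>m = 0\<close> every
  nonempty set has size 1, whence the separate case of the empty set.
\<close>
definition hausdorff_size :: "nat \<Rightarrow> 'a::metric_space set \<Rightarrow> ennreal" where
  "hausdorff_size m U =
     (if U = {} then 0 else ennreal (unit_ball_vol (real m) * (diameter U / 2) ^ m))"

text \<open>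
  Boundedness of the covering sets is required explicitly because \<^const>\<open>diameter\<close> is real-valued
  and unspecified on unbounded sets.
\<close>
definition hausdorff_premeasure :: "nat \<Rightarrow> real \<Rightarrow> 'a::metric_space set \<Rightarrow> ennreal" where
  "hausdorff_premeasure m \<delta> A =
     (INF U \<in> {U :: nat \<Rightarrow> 'a set. A \<subseteq> (\<Union>i. U i) \<and> (\<forall>i. bounded (U i) \<and> diameter (U i) \<le> \<delta>)}.
        \<Sum>i. hausdorff_size m (U i))"

text \<open>This is the outer measure, defined on all subsets.\<close>
definition hausdorff_measure :: "nat \<Rightarrow> 'a::metric_space set \<Rightarrow> ennreal" where
  "hausdorff_measure m A = (SUP \<delta> \<in> {0<..}. hausdorff_premeasure m \<delta> A)"

section \<open>Lipschitz maps from Euclidean spaces of varying dimension\<close>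

text \<open>
  Since \<open>m\<close> varies within one statement, real \<open>m\<close>-space cannot be a type. It is represented by the
  extensional functions on \<open>{..<m}\<close>, with the product (that is, Borel) sigma-algebra. The metric
  instance that the library gives to functions from \<open>nat\<close> to \<open>real\<close> is not the Euclidean one, so
  boundedness and the Lipschitz property are spelled out with the Euclidean norm.
\<close>
definition Rm :: "nat \<Rightarrow> (nat \<Rightarrow> real) measure" where
  "Rm m = Pi\<^sub>M {..<m} (\<lambda>_. borel)"

definition Rm_dist :: "nat \<Rightarrow> (nat \<Rightarrow> real) \<Rightarrow> (nat \<Rightarrow> real) \<Rightarrow> real" where
  "Rm_dist m x y = L2_set (\<lambda>i. x i - y i) {..<m}"

definition Rm_bounded :: "nat \<Rightarrow> (nat \<Rightarrow> real) set \<Rightarrow> bool" where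
  "Rm_bounded m A \<longleftrightarrow> A \<subseteq> space (Rm m) \<and> (\<exists>b. \<forall>x\<in>A. L2_set x {..<m} \<le> b)"

definition Rm_Lipschitz_on ::
  "nat \<Rightarrow> (nat \<Rightarrow> real) set \<Rightarrow> ((nat \<Rightarrow> real) \<Rightarrow> 'a::metric_space) \<Rightarrow> bool" where
  "Rm_Lipschitz_on m A f \<longleftrightarrow> (\<exists>L. \<forall>x\<in>A. \<forall>y\<in>A. dist (f x) (f y) \<le> L * Rm_dist m x y)"

section \<open>Rectifiable sets and measures\<close>

text \<open>Finite unions are included, since \<open>A j\<close> may be empty.\<close>
definition countably_rectifiable :: "nat \<Rightarrow> (real ^ 'd) set \<Rightarrow> bool" where
  "countably_rectifiable m F \<longleftrightarrow>
     (\<exists>(f :: nat \<Rightarrow> (nat \<Rightarrow> real) \<Rightarrow> real ^ 'd) A.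
        (\<forall>j. Rm_bounded m (A j) \<and> Rm_Lipschitz_on m (A j) (f j)) \<and> F = (\<Union>j. f j ` A j))"

definition countably_H_rectifiable :: "nat \<Rightarrow> (real ^ 'd) set \<Rightarrow> bool" where
  "countably_H_rectifiable m E \<longleftrightarrow>
     (\<exists>F. countably_rectifiable m F \<and> hausdorff_measure m (E - F) = 0)"

definition radon_measure :: "(real ^ 'd) measure \<Rightarrow> bool" where
  "radon_measure \<nu> \<longleftrightarrow>
     sets \<nu> = sets borel \<and>
     (\<forall>K. compact K \<longrightarrow> emeasure \<nu> K < \<infinity>) \<and>
     (\<forall>A\<in>sets borel. emeasure \<nu> A = (SUP K \<in> {K. K \<subseteq> A \<and> compact K}. emeasure \<nu> K))"

text \<open>Absolute continuity with respect to Hausdorff measure restricted to \<open>E\<close>.\<close>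
definition abs_cont_hausdorff :: "nat \<Rightarrow> (real ^ 'd) set \<Rightarrow> (real ^ 'd) measure \<Rightarrow> bool" where
  "abs_cont_hausdorff m E \<nu> \<longleftrightarrow>
     (\<forall>A\<in>sets borel. hausdorff_measure m (A \<inter> E) = 0 \<longrightarrow> emeasure \<nu> A = 0)"

definition rectifiable_measure :: "nat \<Rightarrow> (real ^ 'd) measure \<Rightarrow> bool" where
  "rectifiable_measure m \<nu> \<longleftrightarrow>
     radon_measure \<nu> \<and> abs_cont_hausdorff m UNIV \<nu> \<and>
     (\<exists>E\<in>sets borel. countably_H_rectifiable m E \<and> emeasure \<nu> (UNIV - E) = 0)"

definition rectifiable_carrier :: "nat \<Rightarrow> (real ^ 'd) measure \<Rightarrow> (real ^ 'd) set \<Rightarrow> bool" where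
  "rectifiable_carrier m \<nu> E \<longleftrightarrow>
     rectifiable_measure m \<nu> \<and> emeasure \<nu> UNIV \<noteq> 0 \<and>
     (\<exists>(f :: nat \<Rightarrow> (nat \<Rightarrow> real) \<Rightarrow> real ^ 'd) C.
        (\<forall>j. Rm_Lipschitz_on m (space (Rm m)) (f j) \<and>
             C j \<in> sets (Rm m) \<and> Rm_bounded m (C j) \<and> inj_on (f j) (C j)) \<and>
        E = (\<Union>j. f j ` C j)) \<and>
     abs_cont_hausdorff m E \<nu>"

definition dimensional_regular :: "nat \<Rightarrow> (real ^ 'd) measure \<Rightarrow> bool" where
  "dimensional_regular m \<nu> \<longleftrightarrow>
     prob_space \<nu> \<and> rectifiable_measure m \<nu> \<and> has_information_dimension \<nu> (ereal (real m))"

text \<open>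
  \<open>\<rho> = (\<Sum>i=1..k. q i * \<nu> i)\<close> is a stratified probability measure in standard form, where \<open>\<nu> i\<close> is
  \<open>m i\<close>-rectifiable with carrier \<open>E i\<close>.
\<close>
definition stratified_standard_form ::
  "(real ^ 'd) measure \<Rightarrow> nat \<Rightarrow> (nat \<Rightarrow> real) \<Rightarrow> (nat \<Rightarrow> nat) \<Rightarrow>
   (nat \<Rightarrow> (real ^ 'd) measure) \<Rightarrow> (nat \<Rightarrow> (real ^ 'd) set) \<Rightarrow> bool" where
  "stratified_standard_form \<rho> k q m \<nu> E \<longleftrightarrow>
     prob_space \<rho> \<and> sets \<rho> = sets borel \<and>
     (\<forall>A\<in>sets borel. emeasure \<rho> A = (\<Sum>i=1..k. ennreal (q i) * emeasure (\<nu> i) A)) \<and>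
     (\<forall>i\<in>{1..k}. 0 < q i) \<and> (\<Sum>i=1..k. q i) = 1 \<and>
     (\<forall>i\<in>{1..k}. prob_space (\<nu> i) \<and> rectifiable_measure (m i) (\<nu> i) \<and>
                  rectifiable_carrier (m i) (\<nu> i) (E i)) \<and>
     strict_mono_on {1..k} m \<and> (\<forall>i\<in>{1..k}. m i \<le> CARD('d)) \<and>
     disjoint_family_on E {1..k}"

end

theory Submission
  imports Defs
begin

text \<open>
  Write \<open>\<eta> p = - p ln p\<close>. Concavity of \<open>\<eta>\<close> gives \<open>(\<Sum>i. q\<^sub>i H(\<nu>\<^sub>i)) \<le> H(\<rho>)\<close>. Subadditivity of \<open>\<eta>\<close>
  and \<open>\<eta> (q p) = q \<eta> p + p \<eta> q\<close> give \<open>H(\<rho>) \<le> (\<Sum>i. q\<^sub>i H(\<nu>\<^sub>i)) + (\<Sum>i. \<eta> q\<^sub>i)\<close>, because the cells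
  of a grid are disjoint. The additive error does not depend on the grid, so it vanishes after
  division by \<open>ln n\<close>.
\<close>

text \<open>The right-hand side is the tangent line at \<open>y\<close> of the concave function
  \<open>- x ln x\<close>, evaluated at \<open>x\<close>. For \<open>x > 0\<close> the bound is
  \<open>ln t \<le> t - 1\<close> at \<open>t = y / x\<close>, multiplied by
  \<open>x\<close>.\<close>

lemma neg_mult_ln_le_tangent:
  fixes x y :: real
  assumes "0 \<le> x" "0 < y"
  shows "- (x * ln x) \<le> - (x * ln y) + y - x"
proof (cases "x = 0")
  case False
  then have "x * ln (y / x) \<le> x * (y / x - 1)"
    using assms by (intro mult_left_mono ln_le_minus_one) auto
  then show ?thesis
    using assms False by (simp add: ln_div algebra_simps)
qed (use assms in auto)

text \<open>Jensen's inequality: average the tangent bounds taken at the mean \<open>s\<close>.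
  Since the weights sum to 1, the terms \<open>+ s\<close> and \<open>- p i\<close> cancel in the
  average.\<close>

lemma neg_mult_ln_mixture_lower:
  fixes q p :: "'i \<Rightarrow> real"
  assumes "finite I" and q: "\<And>i. i \<in> I \<Longrightarrow> 0 \<le> q i" "(\<Sum>i\<in>I. q i) = 1"
    and p: "\<And>i. i \<in> I \<Longrightarrow> 0 \<le> p i"
  defines "s \<equiv> \<Sum>i\<in>I. q i * p i"
  shows "(\<Sum>i\<in>I. q i * - (p i * ln (p i))) \<le> - (s * ln s)"
\<comment> \<open>The tangent at 0 is vertical, so a vanishing mean is treated apart: then every
  \<open>q i * p i\<close> is 0 and both sides vanish.\<close>
proof (cases "s = 0")
  case True
  then have "\<forall>i\<in>I. q i * p i = 0"
    using assms by (subst (asm) s_def, subst (asm) sum_nonneg_eq_0_iff) auto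
  then have "(\<Sum>i\<in>I. q i * - (p i * ln (p i))) = 0"
    by (intro sum.neutral) auto
  then show ?thesis using True by simp
next
  case False
  moreover have "0 \<le> s" unfolding s_def using q p by (intro sum_nonneg) auto
  ultimately have "0 < s" by simp
  then have "(\<Sum>i\<in>I. q i * - (p i * ln (p i))) \<le> (\<Sum>i\<in>I. q i * (- (p i * ln s) + s - p i))"
    using q p by (intro sum_mono mult_left_mono neg_mult_ln_le_tangent) auto
  also have "\<dots> = - ((\<Sum>i\<in>I. q i * p i) * ln s) + (\<Sum>i\<in>I. q i) * s - (\<Sum>i\<in>I. q i * p i)"
    by (simp add: algebra_simps sum.distrib sum_subtractf sum_negf sum_distrib_left)
  also have "\<dots> = - (s * ln s)"
    using q by (simp flip: s_def)
  finally show ?thesis .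
qed

text \<open>Each \<open>q i * p i\<close> is at most \<open>s\<close>, so replacing
  \<open>ln s\<close> by \<open>ln (q i * p i)\<close> in the \<open>i\<close>-th term only
  increases it; the logarithm of the product then splits. The error term keeps its factor
  \<open>p i\<close>, which makes it summable over infinitely many cells.\<close>

lemma neg_mult_ln_mixture_upper:
  fixes q p :: "'i \<Rightarrow> real"
  assumes "finite I" and q: "\<And>i. i \<in> I \<Longrightarrow> 0 < q i" and p: "\<And>i. i \<in> I \<Longrightarrow> 0 \<le> p i"
  defines "s \<equiv> \<Sum>i\<in>I. q i * p i"
  shows "- (s * ln s) \<le> (\<Sum>i\<in>I. q i * - (p i * ln (p i)) + - (q i * ln (q i)) * p i)"
proof -
  have nonneg: "0 \<le> q i * p i" if "i \<in> I" for i
    using q[OF that] p[OF that] by simp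
  have "- (s * ln s) = (\<Sum>i\<in>I. - (q i * p i * ln s))"
    by (simp add: s_def sum_negf flip: sum_distrib_right)
  also have "\<dots> \<le> (\<Sum>i\<in>I. q i * - (p i * ln (p i)) + - (q i * ln (q i)) * p i)"
  proof (rule sum_mono)
    fix i assume i: "i \<in> I"
    show "- (q i * p i * ln s) \<le> q i * - (p i * ln (p i)) + - (q i * ln (q i)) * p i"
    proof (cases "p i = 0")
      case False
      then have pos: "0 < p i" "0 < q i" "0 < q i * p i"
        using q[OF i] p[OF i] by simp_all
      have "q i * p i \<le> s"
        unfolding s_def using i nonneg \<open>finite I\<close> by (intro member_le_sum) auto
      then have "ln (q i * p i) \<le> ln s"
        using pos(3) by (intro ln_mono) auto
      then have "q i * p i * ln (q i * p i) \<le> q i * p i * ln s"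
        using pos by (intro mult_left_mono) auto
      then show ?thesis
        using pos by (simp add: ln_mult algebra_simps)
    qed simp
  qed
  finally show ?thesis .
qed

lemma grid_cell_borel [measurable]: "grid_cell n j \<in> sets borel"
  unfolding grid_cell_def by measurable

text \<open>A point determines its cell: the floors of the coordinates of \<open>n x\<close> are the
  index.\<close>

lemma disjoint_family_grid_cell:
  assumes "0 < n"
  shows "disjoint_family (grid_cell n :: int ^ 'd \<Rightarrow> _)"
proof (unfold disjoint_family_on_def, intro ballI impI)
  fix j j' :: "int ^ 'd" assume "j \<noteq> j'"
  have index: "\<lfloor>real n * x $ i\<rfloor> = l $ i" if "x \<in> grid_cell n l" for x and l :: "int ^ 'd" and i
    using that assms by (simp add: grid_cell_def floor_eq_iff field_simps)
  have "j = j'" if "x \<in> grid_cell n j" "x \<in> grid_cell n j'" for x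
    using index[OF that(1)] index[OF that(2)] by (simp add: vec_eq_iff)
  with \<open>j \<noteq> j'\<close> show "grid_cell n j \<inter> grid_cell n j' = {}" by auto
qed

lemma nn_integral_grid_cell_le_1:
  fixes \<nu> :: "(real ^ 'd) measure"
  assumes "prob_space \<nu>" "sets \<nu> = sets borel" "0 < n"
  shows "(\<integral>\<^sup>+ j. ennreal (measure \<nu> (grid_cell n j)) \<partial>count_space UNIV) \<le> 1"
proof -
  interpret prob_space \<nu> by fact
  have "(\<integral>\<^sup>+ j. emeasure \<nu> (grid_cell n j) \<partial>count_space UNIV) = emeasure \<nu> (\<Union>j. grid_cell n j)"
    using assms by (intro emeasure_UN_countable[symmetric] disjoint_family_grid_cell) auto
  also have "\<dots> \<le> 1" by (rule measure_le_1)
  finally show ?thesis by (simp add: emeasure_eq_measure)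
qed

text \<open>Both bounds come from summing the pointwise inequalities for \<open>- p ln p\<close>
  over all cells. The sums are taken in \<open>ennreal\<close>, so infinite entropies are covered as
  well.\<close>

lemma discrete_entropy_mixture:
  fixes \<rho> :: "(real ^ 'd) measure" and \<nu> :: "'i \<Rightarrow> (real ^ 'd) measure"
  assumes "finite I" and "prob_space \<rho>" and "0 < n"
    and \<nu>: "\<And>i. i \<in> I \<Longrightarrow> prob_space (\<nu> i)" "\<And>i. i \<in> I \<Longrightarrow> sets (\<nu> i) = sets borel"
    and q: "\<And>i. i \<in> I \<Longrightarrow> 0 < q i" "(\<Sum>i\<in>I. q i) = 1"
    and mix: "\<And>A. A \<in> sets borel \<Longrightarrow> emeasure \<rho> A = (\<Sum>i\<in>I. ennreal (q i) * emeasure (\<nu> i) A)"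
  shows "(\<Sum>i\<in>I. ennreal (q i) * discrete_entropy (\<nu> i) n) \<le> discrete_entropy \<rho> n"
    and "discrete_entropy \<rho> n \<le> (\<Sum>i\<in>I. ennreal (q i) * discrete_entropy (\<nu> i) n)
           + ennreal (\<Sum>i\<in>I. - (q i * ln (q i)))"
proof -
  let ?\<eta> = "\<lambda>x::real. - (x * ln x)"
  let ?p = "\<lambda>i j. measure (\<nu> i) (grid_cell n j)"
  have q01: "0 \<le> q i" "q i \<le> 1" if "i \<in> I" for i
    using q that member_le_sum[of i I q] \<open>finite I\<close> by (auto simp: less_imp_le)
  have p01: "0 \<le> ?p i j" "?p i j \<le> 1" if "i \<in> I" for i j
    using \<nu>(1)[OF that] by (auto simp: prob_space.prob_le_1)
  \<comment> \<open>\<open>ennreal\<close> sends negative reals to 0, so this sign on the unit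
    interval is what allows it to be moved through the sums and products below.\<close>
  have \<eta>: "0 \<le> ?\<eta> x" if "0 \<le> x" "x \<le> 1" for x
    using that by (cases "x = 0") (auto simp: mult_nonneg_nonpos)
  have s: "measure \<rho> (grid_cell n j) = (\<Sum>i\<in>I. q i * ?p i j)" for j
  proof -
    interpret \<rho>: prob_space \<rho> by fact
    have "ennreal (measure \<rho> (grid_cell n j)) = (\<Sum>i\<in>I. ennreal (q i) * emeasure (\<nu> i) (grid_cell n j))"
      by (simp add: mix flip: \<rho>.emeasure_eq_measure)
    also have "\<dots> = (\<Sum>i\<in>I. ennreal (q i * ?p i j))"
      using q01 by (intro sum.cong refl)
        (simp add: ennreal_mult finite_measure.emeasure_eq_measure prob_space.finite_measure \<nu>)
    also have "\<dots> = ennreal (\<Sum>i\<in>I. q i * ?p i j)"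
      using q01 by (intro sum_ennreal) auto
    finally show ?thesis
      using q01 by (subst (asm) ennreal_inj) (auto intro!: sum_nonneg)
  qed
  have avg: "(\<Sum>i\<in>I. ennreal (q i) * discrete_entropy (\<nu> i) n)
      = (\<integral>\<^sup>+ j. ennreal (\<Sum>i\<in>I. q i * ?\<eta> (?p i j)) \<partial>count_space UNIV)"
  proof -
    have "(\<Sum>i\<in>I. ennreal (q i) * discrete_entropy (\<nu> i) n)
        = (\<integral>\<^sup>+ j. (\<Sum>i\<in>I. ennreal (q i) * ennreal (?\<eta> (?p i j))) \<partial>count_space UNIV)"
      by (simp add: discrete_entropy_def nn_integral_sum nn_integral_cmult)
    also have "\<dots> = (\<integral>\<^sup>+ j. ennreal (\<Sum>i\<in>I. q i * ?\<eta> (?p i j)) \<partial>count_space UNIV)"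
    proof (rule nn_integral_cong)
      fix j
      have "(\<Sum>i\<in>I. ennreal (q i) * ennreal (?\<eta> (?p i j))) = (\<Sum>i\<in>I. ennreal (q i * ?\<eta> (?p i j)))"
        using q01 p01 by (intro sum.cong refl ennreal_mult[symmetric] \<eta>) auto
      also have "\<dots> = ennreal (\<Sum>i\<in>I. q i * ?\<eta> (?p i j))"
        using q01 p01 by (intro sum_ennreal mult_nonneg_nonneg \<eta>) auto
      finally show "(\<Sum>i\<in>I. ennreal (q i) * ennreal (?\<eta> (?p i j))) = ennreal (\<Sum>i\<in>I. q i * ?\<eta> (?p i j))" .
    qed
    finally show ?thesis .
  qed
  show "(\<Sum>i\<in>I. ennreal (q i) * discrete_entropy (\<nu> i) n) \<le> discrete_entropy \<rho> n"
    \<comment> \<open>\<open>avg\<close> has to be applied while \<open>discrete_entropy\<close> is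
      still folded, because its left-hand side mentions that constant.\<close>
    unfolding avg unfolding discrete_entropy_def s
    using q q01 p01 \<open>finite I\<close>
    by (intro nn_integral_mono ennreal_leI neg_mult_ln_mixture_lower) auto
  have "discrete_entropy \<rho> n \<le> (\<integral>\<^sup>+ j. ennreal (\<Sum>i\<in>I. q i * ?\<eta> (?p i j))
      + (\<Sum>i\<in>I. ennreal (?\<eta> (q i)) * ennreal (?p i j)) \<partial>count_space UNIV)"
    unfolding discrete_entropy_def
  proof (rule nn_integral_mono)
    fix j
    have "?\<eta> (measure \<rho> (grid_cell n j))
        \<le> (\<Sum>i\<in>I. q i * ?\<eta> (?p i j)) + (\<Sum>i\<in>I. ?\<eta> (q i) * ?p i j)"
      unfolding s sum.distrib[symmetric]
      using \<open>finite I\<close> q p01 by (intro neg_mult_ln_mixture_upper) auto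
    then have "ennreal (?\<eta> (measure \<rho> (grid_cell n j)))
        \<le> ennreal ((\<Sum>i\<in>I. q i * ?\<eta> (?p i j)) + (\<Sum>i\<in>I. ?\<eta> (q i) * ?p i j))"
      by (rule ennreal_leI)
    also have "\<dots> = ennreal (\<Sum>i\<in>I. q i * ?\<eta> (?p i j)) + ennreal (\<Sum>i\<in>I. ?\<eta> (q i) * ?p i j)"
      using q01 p01 by (intro ennreal_plus sum_nonneg mult_nonneg_nonneg \<eta>) auto
    also have "ennreal (\<Sum>i\<in>I. ?\<eta> (q i) * ?p i j) = (\<Sum>i\<in>I. ennreal (?\<eta> (q i) * ?p i j))"
      using q01 p01 by (intro sum_ennreal[symmetric] mult_nonneg_nonneg \<eta>) auto
    also have "\<dots> = (\<Sum>i\<in>I. ennreal (?\<eta> (q i)) * ennreal (?p i j))"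
      using q01 p01 by (intro sum.cong refl ennreal_mult \<eta>) auto
    finally show "ennreal (?\<eta> (measure \<rho> (grid_cell n j)))
        \<le> ennreal (\<Sum>i\<in>I. q i * ?\<eta> (?p i j)) + (\<Sum>i\<in>I. ennreal (?\<eta> (q i)) * ennreal (?p i j))" .
  qed
  also have "\<dots> = (\<Sum>i\<in>I. ennreal (q i) * discrete_entropy (\<nu> i) n)
      + (\<Sum>i\<in>I. ennreal (?\<eta> (q i)) * (\<integral>\<^sup>+ j. ennreal (?p i j) \<partial>count_space UNIV))"
    by (simp add: avg nn_integral_add nn_integral_sum nn_integral_cmult)
  \<comment> \<open>Disjoint cells have total mass at most 1 under each \<open>\<nu> i\<close>, so
    the error loses its dependence on \<open>n\<close>.\<close>
  also have "\<dots> \<le> (\<Sum>i\<in>I. ennreal (q i) * discrete_entropy (\<nu> i) n) + (\<Sum>i\<in>I. ennreal (?\<eta> (q i)) * 1)"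
    using \<nu> \<open>0 < n\<close> by (intro add_left_mono sum_mono mult_left_mono nn_integral_grid_cell_le_1) auto
  also have "(\<Sum>i\<in>I. ennreal (?\<eta> (q i)) * 1) = ennreal (\<Sum>i\<in>I. ?\<eta> (q i))"
    unfolding mult_1_right using q01 by (intro sum_ennreal \<eta>) auto
  finally show "discrete_entropy \<rho> n \<le> (\<Sum>i\<in>I. ennreal (q i) * discrete_entropy (\<nu> i) n)
      + ennreal (\<Sum>i\<in>I. ?\<eta> (q i))" .
qed

text \<open>The terms may be infinite at some points, but the limits are real, and
  \<open>ereal\<close> addition is continuous at pairs of finite values.\<close>

lemma tendsto_sum_cmult_ereal:
  fixes f :: "'i \<Rightarrow> 'b \<Rightarrow> ereal"
  assumes "finite I" "\<And>i. i \<in> I \<Longrightarrow> (f i \<longlongrightarrow> ereal (d i)) F"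
  shows "((\<lambda>x. \<Sum>i\<in>I. ereal (q i) * f i x) \<longlongrightarrow> ereal (\<Sum>i\<in>I. q i * d i)) F"
  using assms
proof (induction I rule: finite_induct)
  case (insert i I)
  have "((\<lambda>x. ereal (q i) * f i x) \<longlongrightarrow> ereal (q i) * ereal (d i)) F"
    using insert.prems by (intro tendsto_cmult_ereal) auto
  then have "((\<lambda>x. ereal (q i) * f i x + (\<Sum>i\<in>I. ereal (q i) * f i x))
      \<longlongrightarrow> ereal (q i * d i) + ereal (\<Sum>i\<in>I. q i * d i)) F"
    using insert by (intro tendsto_add_ereal) auto
  then show ?case using insert.hyps by simp
qed (simp add: zero_ereal_def)

text \<open>The quotient for \<open>\<rho>\<close> is squeezed between the weighted average
  \<open>?A\<close> of the component quotients and \<open>?A\<close> plus a constant over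
  \<open>ln n\<close>.\<close>

lemma has_information_dimension_mixture:
  fixes \<rho> :: "(real ^ 'd) measure" and \<nu> :: "'i \<Rightarrow> (real ^ 'd) measure"
  assumes "finite I" and "prob_space \<rho>"
    and \<nu>: "\<And>i. i \<in> I \<Longrightarrow> prob_space (\<nu> i)" "\<And>i. i \<in> I \<Longrightarrow> sets (\<nu> i) = sets borel"
    and q: "\<And>i. i \<in> I \<Longrightarrow> 0 < q i" "(\<Sum>i\<in>I. q i) = 1"
    and mix: "\<And>A. A \<in> sets borel \<Longrightarrow> emeasure \<rho> A = (\<Sum>i\<in>I. ennreal (q i) * emeasure (\<nu> i) A)"
    and dim: "\<And>i. i \<in> I \<Longrightarrow> has_information_dimension (\<nu> i) (ereal (d i))"
  shows "has_information_dimension \<rho> (ereal (\<Sum>i\<in>I. q i * d i))"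
proof -
  let ?h = "\<lambda>\<mu> n. enn2ereal (discrete_entropy \<mu> n) / ereal (ln (real n))"
  let ?A = "\<lambda>n. \<Sum>i\<in>I. ereal (q i) * ?h (\<nu> i) n"
  define C where "C = (\<Sum>i\<in>I. - (q i * ln (q i)))"
  \<comment> \<open>Needed both to read \<open>ennreal C\<close> back as \<open>C\<close> and to
    distribute the division over the sum in \<open>ereal\<close>.\<close>
  have "0 \<le> C"
    unfolding C_def
  proof (rule sum_nonneg)
    fix i assume i: "i \<in> I"
    then have "0 < q i" "q i \<le> 1"
      using q member_le_sum[of i I q] \<open>finite I\<close> by (auto simp: less_imp_le)
    then show "0 \<le> - (q i * ln (q i))" by (simp add: mult_nonneg_nonpos)
  qed
  have A: "?A \<longlonglongrightarrow> ereal (\<Sum>i\<in>I. q i * d i)"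
    using dim \<open>finite I\<close> by (intro tendsto_sum_cmult_ereal) (auto simp: has_information_dimension_def)
  have "(\<lambda>n. C / ln (real n)) \<longlonglongrightarrow> 0"
    by (intro real_tendsto_divide_at_top[OF tendsto_const]
        filterlim_compose[OF ln_at_top filterlim_real_sequentially])
  then have C: "(\<lambda>n. ereal (C / ln (real n))) \<longlonglongrightarrow> ereal 0"
    by (rule tendsto_ereal)
  have AC: "(\<lambda>n. ?A n + ereal (C / ln (real n))) \<longlonglongrightarrow> ereal (\<Sum>i\<in>I. q i * d i)"
    using tendsto_add_ereal[OF _ _ A C] by simp
  \<comment> \<open>From \<open>n = 2\<close> on, \<open>ln n\<close> is positive, so dividing by it
    preserves order.\<close>
  have bounds: "?A n \<le> ?h \<rho> n \<and> ?h \<rho> n \<le> ?A n + ereal (C / ln (real n))" if "2 \<le> n" for n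
  proof -
    define S where "S = (\<Sum>i\<in>I. ennreal (q i) * discrete_entropy (\<nu> i) n)"
    have ln: "0 < ln (real n)" using that by simp
    have "enn2ereal S = (\<Sum>i\<in>I. ereal (q i) * enn2ereal (discrete_entropy (\<nu> i) n))"
      unfolding S_def using q(1)
      by (subst sum_enn2ereal[symmetric]) (auto simp: times_ennreal.rep_eq less_imp_le intro!: sum.cong)
    then have S: "enn2ereal S / ereal (ln (real n)) = ?A n"
      using q(1) by (simp add: divide_ereal_def sum_ereal_left_distrib less_imp_le mult.assoc)
    have "S \<le> discrete_entropy \<rho> n" "discrete_entropy \<rho> n \<le> S + ennreal C"
      unfolding S_def C_def using that
      by (intro discrete_entropy_mixture[OF \<open>finite I\<close> \<open>prob_space \<rho>\<close> _ \<nu> q mix]; simp)+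
    then have "enn2ereal S \<le> enn2ereal (discrete_entropy \<rho> n)"
        "enn2ereal (discrete_entropy \<rho> n) \<le> enn2ereal S + ereal C"
      using \<open>0 \<le> C\<close> by (simp_all add: less_eq_ennreal.rep_eq plus_ennreal.rep_eq)
    then have "enn2ereal S / ereal (ln (real n)) \<le> ?h \<rho> n"
        "?h \<rho> n \<le> (enn2ereal S + ereal C) / ereal (ln (real n))"
      using ln by (intro ereal_divide_right_mono; simp)+
    \<comment> \<open>\<open>S\<close> may be infinite; distributivity holds because both summands
      are nonnegative.\<close>
    moreover have "(enn2ereal S + ereal C) / ereal (ln (real n))
        = enn2ereal S / ereal (ln (real n)) + ereal (C / ln (real n))"
      using ln \<open>0 \<le> C\<close> by (simp add: divide_ereal_def ereal_left_distrib divide_inverse)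
    ultimately show ?thesis by (simp add: S)
  qed
  show ?thesis
    unfolding has_information_dimension_def
    by (rule tendsto_sandwich[OF _ _ A AC]; use bounds in \<open>auto simp: eventually_sequentially\<close>)
qed

theorem proposition9:
  fixes M :: "'a measure" and X :: "'a \<Rightarrow> real ^ 'd"
    and \<rho> :: "(real ^ 'd) measure" and \<nu> :: "nat \<Rightarrow> (real ^ 'd) measure"
    and k :: nat and q :: "nat \<Rightarrow> real" and m :: "nat \<Rightarrow> nat"
    and E :: "nat \<Rightarrow> (real ^ 'd) set"
  assumes "prob_space M"
    and "X \<in> borel_measurable M"
    and "\<rho> = distr M borel X"
    and "stratified_standard_form \<rho> k q m \<nu> E"
    and "\<And>i. i \<in> {1..k} \<Longrightarrow> dimensional_regular (m i) (\<nu> i)"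
  shows "has_information_dimension \<rho> (ereal (\<Sum>i=1..k. q i * real (m i)))"
  \<comment> \<open>The Borel sigma-algebra of each \<open>\<nu> i\<close> is part of
    \<open>radon_measure\<close>; the limit \<open>m i\<close> of its quotient comes from
    \<open>dimensional_regular\<close>.\<close>
  using assms(4,5)
  by (intro has_information_dimension_mixture[where \<nu> = \<nu>])
    (auto simp: stratified_standard_form_def dimensional_regular_def rectifiable_measure_def
      radon_measure_def)

end
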